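(* Let $n\in\{5,6,7\}$ and let $g$ be a positive integer such that $gn\equiv 0 \pmod 2$, $g(n-1)(n-2)\equiv 0\pmod 3$, and $(n,g)\neq(5,2)$. Then a large set of H-designs LH$(n,g,4,3)$ exists, with possible exceptions when $n=5$ and $g\equiv 2\pmod 4$.
   Context: An H-design H$(n,g,k,t)$ is a triple $(Q,G,B)$ where $Q$ is a set of $ng$ points, $G$ is a partition of $Q$ into $n$ groups of size $g$, and $B$ is a set of $k$-subsets of $Q$ (blocks) such that each block meets each group in at most one point and any $t$ points from $t$ distinct groups lie in exactly one block. A large set of H-designs LH$(n,g,k,t)$ is a partition of the set of all $k$-subsets of $Q$ meeting each group of $G$ in at most one point into pairwise disjoint block sets, each of which forms (with $Q$ and $G$) an H-design H$(n,g,k,t)$. (The paper calls parameters "admissible" when they satisfy the known necessary and sufficient conditions for existence of an H$(n,g,4,3)$: $gn\equiv0 \pmod 2$, $g(n-1)(n-2)\equiv 0\pmod 3$, $n\ge 4$, $(n,g)\ne(5,2)$.) *)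

theory Defs
  imports Main
begin

definition transversal :: "'a set set \<Rightarrow> 'a set \<Rightarrow> bool" where
  "transversal G S \<longleftrightarrow> (\<forall>X\<in>G. card (S \<inter> X) \<le> 1)"

definition group_partition :: "nat \<Rightarrow> nat \<Rightarrow> 'a set \<Rightarrow> 'a set set \<Rightarrow> bool" where
  "group_partition n g Q G \<longleftrightarrow>
     finite Q \<and> card Q = n * g \<and> \<Union>G = Q \<and> card G = n \<and>
     (\<forall>X\<in>G. X \<subseteq> Q \<and> card X = g) \<and>
     (\<forall>X\<in>G. \<forall>Y\<in>G. X \<noteq> Y \<longrightarrow> X \<inter> Y = {})"

definition transversal_ksets :: "nat \<Rightarrow> 'a set \<Rightarrow> 'a set set \<Rightarrow> 'a set set" where
  "transversal_ksets k Q G = {S. S \<subseteq> Q \<and> card S = k \<and> transversal G S}"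

definition H_design :: "nat \<Rightarrow> nat \<Rightarrow> nat \<Rightarrow> nat \<Rightarrow> 'a set \<Rightarrow> 'a set set \<Rightarrow> 'a set set \<Rightarrow> bool" where
  "H_design n g k t Q G B \<longleftrightarrow>
     group_partition n g Q G \<and>
     B \<subseteq> transversal_ksets k Q G \<and>
     (\<forall>T \<in> transversal_ksets t Q G. \<exists>!b. b \<in> B \<and> T \<subseteq> b)"

definition large_set_H :: "nat \<Rightarrow> nat \<Rightarrow> nat \<Rightarrow> nat \<Rightarrow> 'a set \<Rightarrow> 'a set set \<Rightarrow> 'a set set set \<Rightarrow> bool" where
  "large_set_H n g k t Q G F \<longleftrightarrow>
     group_partition n g Q G \<and>
     \<Union>F = transversal_ksets k Q G \<and>
     (\<forall>B1\<in>F. \<forall>B2\<in>F. B1 \<noteq> B2 \<longrightarrow> B1 \<inter> B2 = {}) \<and>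
     (\<forall>B\<in>F. H_design n g k t Q G B)"

definition LH_exists :: "nat \<Rightarrow> nat \<Rightarrow> nat \<Rightarrow> nat \<Rightarrow> bool" where
  "LH_exists n g k t \<longleftrightarrow> (\<exists>(Q::nat set) G F. large_set_H n g k t Q G F)"

end

theory Submission
  imports Defs
begin

text \<open>
  A large set of H-designs with \<open>k = t + 1\<close> is the same thing as a colouring of the transversal
  \<open>(t + 1)\<close>-sets in which, for every transversal \<open>t\<close>-set \<open>T\<close>, each colour occurs exactly once
  among the \<open>(t + 1)\<close>-sets containing \<open>T\<close>. Such a colouring survives replacing every point by \<open>m\<close>
  copies indexed by residues modulo \<open>m\<close>: colour a set by the colour of its projection together with
  the sum of its indices modulo \<open>m\<close>. The arithmetic conditions leave \<open>4 dvd g\<close> for \<open>n = 5\<close>,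
  \<open>3 dvd g\<close> for \<open>n = 6\<close> and \<open>2 dvd g\<close> for \<open>n = 7\<close>, so it is enough to colour the three cases
  \<open>(n, g) = (5, 4), (6, 3), (7, 2)\<close>.
\<close>

section \<open>Arithmetic of indices and residues\<close>

lemma mixed_radix_less:
  fixes i a n g :: nat
  assumes "i < n" "a < g"
  shows "i * g + a < n * g"
proof -
  have "i * g + a < Suc i * g" using assms by simp
  also have "\<dots> \<le> n * g" using assms by (intro mult_le_mono) auto
  finally show ?thesis .
qed

lemma bij_betw_add_mod:
  fixes s m :: nat
  shows "bij_betw (\<lambda>x. (x + s) mod m) {..<m} {..<m}"
proof -
  have "inj_on (\<lambda>x. (x + s) mod m) {..<m}"
  proof (rule inj_onI)
    fix x y assume xy: "x \<in> {..<m}" "y \<in> {..<m}" and "(x + s) mod m = (y + s) mod m"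
    then obtain a b where "x + s + m * a = y + s + m * b" by (auto simp: nat_mod_eq_iff)
    then have "x + m * a = y + m * b" by simp
    then have "x mod m = y mod m" by (auto simp: nat_mod_eq_iff)
    then show "x = y" using xy by simp
  qed
  moreover have "(\<lambda>x. (x + s) mod m) ` {..<m} \<subseteq> {..<m}" by auto
  ultimately show ?thesis by (simp add: bij_betw_def endo_inj_surj)
qed

section \<open>Concrete groups, transversals and their one-point extensions\<close>

definition interval_groups :: "nat \<Rightarrow> nat \<Rightarrow> nat set set" where
  "interval_groups n g = (\<lambda>i. {p. p < n * g \<and> p div g = i}) ` {..<n}"

lemma card_interval_group:
  assumes "i < n"
  shows "card {p. p < n * g \<and> p div g = i} = g"
proof (cases "g = 0")
  case False
  have "{p. p < n * g \<and> p div g = i} = (\<lambda>a. i * g + a) ` {..<g}"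
  proof (intro equalityI subsetI)
    fix p assume "p \<in> {p. p < n * g \<and> p div g = i}"
    then have "p = i * g + p mod g" "p mod g < g" using False by auto
    then show "p \<in> (\<lambda>a. i * g + a) ` {..<g}" by blast
  qed (use assms mixed_radix_less in auto)
  then show ?thesis by (simp add: card_image inj_on_def)
qed simp

lemma group_partition_interval_groups:
  assumes "g > 0"
  shows "group_partition n g {..<n * g} (interval_groups n g)"
proof -
  have "inj_on (\<lambda>i. {p. p < n * g \<and> p div g = i}) {..<n}"
  proof (rule inj_onI)
    fix i j assume ij: "i \<in> {..<n}" "j \<in> {..<n}"
      and eq: "{p. p < n * g \<and> p div g = i} = {p. p < n * g \<and> p div g = j}"
    \<comment> \<open>\<open>i * g\<close> is the first point of group \<open>i\<close>. Such a
      witness needs \<open>g > 0\<close>: empty groups would all coincide.\<close>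
    have "i * g \<in> {p. p < n * g \<and> p div g = i}" using ij assms by simp
    then show "i = j" unfolding eq using assms by simp
  qed
  then have "card (interval_groups n g) = n"
    unfolding interval_groups_def by (simp add: card_image)
  then show ?thesis
    unfolding group_partition_def
    by (auto simp: interval_groups_def card_interval_group less_mult_imp_div_less)
qed

definition transversals :: "nat \<Rightarrow> nat \<Rightarrow> nat \<Rightarrow> nat set set" where
  "transversals n g k = {S. S \<subseteq> {..<n * g} \<and> card S = k \<and> inj_on (\<lambda>p. p div g) S}"

lemma transversal_ksets_interval_groups:
  "transversal_ksets k {..<n * g} (interval_groups n g) = transversals n g k"
proof -
  have "transversal (interval_groups n g) S \<longleftrightarrow> inj_on (\<lambda>p. p div g) S"
    if S: "S \<subseteq> {..<n * g}" for S
  proof -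
    have fin: "finite S" using S finite_subset by blast
    have "transversal (interval_groups n g) S \<longleftrightarrow>
        (\<forall>i<n. \<forall>x\<in>S. \<forall>y\<in>S. x div g = i \<longrightarrow> y div g = i \<longrightarrow> x = y)"
      unfolding transversal_def interval_groups_def
      using S fin by (auto simp: card_le_Suc0_iff_eq)
    also have "\<dots> \<longleftrightarrow> inj_on (\<lambda>p. p div g) S"
      using S less_mult_imp_div_less[of _ n g] unfolding inj_on_def by blast
    finally show ?thesis .
  qed
  then show ?thesis
    unfolding transversal_ksets_def transversals_def by auto
qed

lemma finite_transversal: "S \<in> transversals n g k \<Longrightarrow> finite S"
  by (auto simp: transversals_def intro: finite_subset)

definition extensions :: "nat \<Rightarrow> nat \<Rightarrow> nat set \<Rightarrow> nat set" where
  "extensions n g T = {p. p < n * g \<and> p div g \<notin> (\<lambda>q. q div g) ` T}"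

lemma insert_extension:
  assumes "T \<in> transversals n g t" "p \<in> extensions n g T"
  shows "insert p T \<in> transversals n g (Suc t)"
proof -
  have "p \<notin> T" using assms(2) by (auto simp: extensions_def)
  then show ?thesis
    using assms finite_transversal[OF assms(1)]
    by (auto simp: transversals_def extensions_def)
qed

lemma superset_transversal:
  assumes "S \<in> transversals n g (Suc t)" "T \<in> transversals n g t" "T \<subseteq> S"
  obtains p where "p \<in> extensions n g T" "S = insert p T"
proof -
  have "card (S - T) = 1"
    using assms finite_transversal[OF assms(2)] by (simp add: card_Diff_subset transversals_def)
  then obtain p where "S - T = {p}" by (rule card_1_singletonE)
  then have p: "S = insert p T" "p \<notin> T" using assms(3) by auto
  then have "p \<in> extensions n g T"
    using assms(1) by (auto simp: transversals_def extensions_def)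
  then show thesis using p(1) by (rule that)
qed

text \<open>The colouring condition speaks of \<open>t\<close>-sets; this lets it control the colour
  of every transversal \<open>Suc t\<close>-set.\<close>

lemma transversal_remove:
  assumes "S \<in> transversals n g (Suc t)"
  obtains T p where "T \<in> transversals n g t" "p \<in> extensions n g T" "S = insert p T"
proof -
  have S: "S \<subseteq> {..<n * g}" "card S = Suc t" "inj_on (\<lambda>p. p div g) S"
    using assms by (auto simp: transversals_def)
  then obtain p where "p \<in> S" by fastforce
  then have T: "S - {p} \<in> transversals n g t"
    using S by (auto simp: transversals_def card_Diff_singleton intro: inj_on_subset)
  then show thesis
    by (rule superset_transversal[OF assms]) (use T that in auto)
qed

section \<open>Large sets from colourings\<close>

definition large_set_colouring ::
    "nat \<Rightarrow> nat \<Rightarrow> nat \<Rightarrow> 'c set \<Rightarrow> (nat set \<Rightarrow> 'c) \<Rightarrow> bool" where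
  "large_set_colouring n g t C f \<longleftrightarrow>
     (\<forall>T\<in>transversals n g t. bij_betw (\<lambda>p. f (insert p T)) (extensions n g T) C)"

text \<open>The designs are the colour classes \<open>B c\<close>: over a \<open>t\<close>-set,
  surjectivity onto \<open>C\<close> yields a block of each colour and injectivity makes it
  unique.\<close>

lemma LH_exists_if_colouring:
  assumes "g > 0" and f: "large_set_colouring n g t C f"
  shows "LH_exists n g (Suc t) t"
proof -
  define B where "B c = {S \<in> transversals n g (Suc t). f S = c}" for c
  note bij = f[unfolded large_set_colouring_def, rule_format]
  have colour: "f S \<in> C" if S: "S \<in> transversals n g (Suc t)" for S
  proof -
    obtain T p where "T \<in> transversals n g t" "p \<in> extensions n g T" "S = insert p T"
      using transversal_remove[OF S] .
    then show ?thesis using bij_betwE[OF bij] by simp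
  qed
  have unique: "\<exists>!S. S \<in> B c \<and> T \<subseteq> S" if T: "T \<in> transversals n g t" and c: "c \<in> C" for T c
  proof -
    have "c \<in> (\<lambda>p. f (insert p T)) ` extensions n g T"
      using bij_betw_imp_surj_on[OF bij[OF T]] c by simp
    then obtain p where p: "p \<in> extensions n g T" "f (insert p T) = c" by auto
    show ?thesis
    proof (intro ex1I conjI)
      show "insert p T \<in> B c" using insert_extension[OF T p(1)] p(2) by (simp add: B_def)
    next
      fix S assume "S \<in> B c \<and> T \<subseteq> S"
      then have S: "S \<in> transversals n g (Suc t)" "T \<subseteq> S" "f S = c" by (auto simp: B_def)
      obtain q where q: "q \<in> extensions n g T" "S = insert q T"
        using superset_transversal[OF S(1) T S(2)] .
      then have "q = p"
        using inj_onD[OF bij_betw_imp_inj_on[OF bij[OF T]]] S(3) p by simp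
      then show "S = insert p T" using q by simp
    qed auto
  qed
  have "H_design n g (Suc t) t {..<n * g} (interval_groups n g) (B c)" if "c \<in> C" for c
    unfolding H_design_def transversal_ksets_interval_groups
    using group_partition_interval_groups[OF assms(1)] unique that by (simp add: B_def)
  moreover have "\<Union> (B ` C) = transversals n g (Suc t)"
    using colour by (auto simp: B_def)
  moreover have "B c \<inter> B d = {}" if "B c \<noteq> B d" for c d
    using that by (auto simp: B_def)
  ultimately have "large_set_H n g (Suc t) t {..<n * g} (interval_groups n g) (B ` C)"
    unfolding large_set_H_def transversal_ksets_interval_groups
    using group_partition_interval_groups[OF assms(1)] by simp
  then show ?thesis unfolding LH_exists_def by blast
qed

section \<open>Inflation of the groups\<close>

definition inflate :: "nat \<Rightarrow> (nat set \<Rightarrow> 'c) \<Rightarrow> nat set \<Rightarrow> 'c \<times> nat" where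
  "inflate m f S = (f ((\<lambda>p. p div m) ` S), (\<Sum>p\<in>S. p mod m) mod m)"

text \<open>A new point \<open>p\<close> acts through two independent coordinates:
  \<open>p div m\<close> is coloured over the projection \<open>T\<close> of \<open>T'\<close>,
  while \<open>p mod m\<close> is translated by the fixed index sum \<open>s\<close> of
  \<open>T'\<close>. Both maps are bijections, hence so is their product.\<close>

lemma large_set_colouring_inflate:
  assumes "m > 0" and f: "large_set_colouring n g t C f"
  shows "large_set_colouring n (g * m) t (C \<times> {..<m}) (inflate m f)"
  unfolding large_set_colouring_def
proof
  fix T' assume T': "T' \<in> transversals n (g * m) t"
  define s T where "s = (\<Sum>p\<in>T'. p mod m)" and "T = (\<lambda>p. p div m) ` T'"
  \<comment> \<open>The \<open>m\<close> copies of a point are consecutive numbers, so projecting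
    preserves the group index.\<close>
  have group: "p div (g * m) = p div m div g" for p
    by (simp add: div_mult2_eq mult.commute[of g])
  have less: "p < n * (g * m) \<longleftrightarrow> p div m < n * g" for p
    using assms(1) by (simp add: div_less_iff_less_mult mult.assoc)
  have "inj_on (\<lambda>p. p div m div g) T'" using T' by (simp add: transversals_def group)
  then have "inj_on (\<lambda>p. p div m) T'" "inj_on (\<lambda>p. p div g) T"
    unfolding T_def by (auto simp: inj_on_def)
  then have T: "T \<in> transversals n g t"
    using T' less by (auto simp: transversals_def T_def card_image)
  have "(\<lambda>p. p div g) ` T = (\<lambda>p. p div (g * m)) ` T'"
    unfolding T_def by (simp add: image_image group)
  then have ext: "p \<in> extensions n (g * m) T' \<longleftrightarrow> p div m \<in> extensions n g T" for p
    unfolding extensions_def by (simp add: less group)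
  have colour: "inflate m f (insert p T') = (f (insert (p div m) T), (p mod m + s) mod m)"
    if "p \<in> extensions n (g * m) T'" for p
  proof -
    have "p \<notin> T'" using that by (auto simp: extensions_def)
    then show ?thesis using finite_transversal[OF T'] by (simp add: inflate_def T_def s_def)
  qed
  let ?E = "extensions n g T" and ?E' = "extensions n (g * m) T'"
  have "bij_betw (\<lambda>p. (p div m, p mod m)) ?E' (?E \<times> {..<m})"
    using assms(1) by (intro bij_betw_byWitness[where f' = "\<lambda>(q, x). q * m + x"]) (auto simp: ext)
  moreover have "bij_betw (map_prod (\<lambda>q. f (insert q T)) (\<lambda>x. (x + s) mod m))
      (?E \<times> {..<m}) (C \<times> {..<m})"
    using f T bij_betw_add_mod unfolding large_set_colouring_def
    by (intro bij_betw_map_prod) auto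
  ultimately have "bij_betw (map_prod (\<lambda>q. f (insert q T)) (\<lambda>x. (x + s) mod m) \<circ>
      (\<lambda>p. (p div m, p mod m))) ?E' (C \<times> {..<m})"
    by (rule bij_betw_trans)
  then show "bij_betw (\<lambda>p. inflate m f (insert p T')) ?E' (C \<times> {..<m})"
    by (rule bij_betw_cong[THEN iffD1, rotated]) (simp add: colour)
qed

corollary LH_exists_multiple:
  assumes "large_set_colouring n g t C f" "g > 0" "m > 0"
  shows "LH_exists n (g * m) (Suc t) t"
  using LH_exists_if_colouring[OF _ large_set_colouring_inflate] assms by simp

section \<open>An executable check for triples\<close>

definition sees_each_colour ::
    "nat \<Rightarrow> nat \<Rightarrow> 'c list \<Rightarrow> ((nat \<times> nat) list \<Rightarrow> 'c) \<Rightarrow> (nat \<times> nat) list \<Rightarrow> bool" where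
  "sees_each_colour n g cs col zs \<longleftrightarrow>
     (let xs = map (\<lambda>x. col (insort_key fst x zs))
                 (List.product (filter (\<lambda>l. l \<notin> set (map fst zs)) [0..<n]) [0..<g])
      in distinct xs \<and> set xs = set cs)"

text \<open>Choosing the last point first and then descending through the groups visits every
  transversal triple exactly once, already sorted by group.\<close>

definition proper_on_triples ::
    "nat \<Rightarrow> nat \<Rightarrow> 'c list \<Rightarrow> ((nat \<times> nat) list \<Rightarrow> 'c) \<Rightarrow> bool" where
  "proper_on_triples n g cs col \<longleftrightarrow>
     list_all (\<lambda>z. list_all (\<lambda>y. list_all (\<lambda>x. sees_each_colour n g cs col [x, y, z])
       (List.product [0..<fst y] [0..<g])) (List.product [0..<fst z] [0..<g]))
       (List.product [0..<n] [0..<g])"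

definition coords :: "nat \<Rightarrow> nat \<Rightarrow> nat \<times> nat" where
  "coords g p = (p div g, p mod g)"

text \<open>Points of different groups compare by number exactly as their groups do, so both
  insertions choose the same place.\<close>

lemma map_coords_insort:
  assumes "p div g \<notin> (\<lambda>q. q div g) ` set ps"
  shows "map (coords g) (insort p ps) = insort_key fst (coords g p) (map (coords g) ps)"
  using assms
proof (induction ps)
  case (Cons q ps)
  have "p \<le> q \<longleftrightarrow> p div g \<le> q div g"
    using Cons.prems div_le_mono[of p q g] div_le_mono[of q p g] by fastforce
  with Cons show ?case by (simp add: coords_def)
qed simp

lemma bij_betw_coords:
  assumes "g > 0"
  shows "bij_betw (coords g) (extensions n g T) (({..<n} - (\<lambda>q. q div g) ` T) \<times> {..<g})"
  using assms
  by (intro bij_betw_byWitness[where f' = "\<lambda>(i, a). i * g + a"])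
    (auto simp: coords_def extensions_def less_mult_imp_div_less mixed_radix_less)

lemma large_set_colouring_if_proper:
  assumes "g > 0" and col: "proper_on_triples n g cs col"
  shows "large_set_colouring n g 3 (set cs) (\<lambda>S. col (map (coords g) (sorted_list_of_set S)))"
  unfolding large_set_colouring_def
proof
  fix T assume T: "T \<in> transversals n g 3"
  then have fin: "finite T" by (rule finite_transversal)
  have "length (sorted_list_of_set T) = Suc (Suc (Suc 0))"
    using T by (simp add: transversals_def)
  then obtain p q r where pqr: "sorted_list_of_set T = [p, q, r]"
    unfolding length_Suc_conv by auto
  then have set: "T = {p, q, r}" using fin set_sorted_list_of_set by fastforce
  have "sorted_wrt (<) [p, q, r]" using strict_sorted_list_of_set[of T] by (simp add: pqr)
  then have "p div g \<le> q div g" "q div g \<le> r div g" "p \<noteq> q" "q \<noteq> r" by (auto intro: div_le_mono)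
  \<comment> \<open>Sorting orders the groups only weakly; transversality makes the order strict, so
    \<open>[p, q, r]\<close> gives one of the enumerated triples.\<close>
  then have lt: "p div g < q div g" "q div g < r div g" "r div g < n"
    using T unfolding transversals_def set
    by (auto simp: inj_on_def less_mult_imp_div_less intro: le_neq_implies_less)
  let ?E = "({..<n} - (\<lambda>p. p div g) ` T) \<times> {..<g}"
  let ?zs = "map (coords g) [p, q, r]"
  let ?es = "List.product (filter (\<lambda>l. l \<notin> set (map fst ?zs)) [0..<n]) [0..<g]"
  let ?h = "\<lambda>x. col (insort_key fst x ?zs)"
  have "coords g r \<in> set (List.product [0..<n] [0..<g])"
    "coords g q \<in> set (List.product [0..<fst (coords g r)] [0..<g])"
    "coords g p \<in> set (List.product [0..<fst (coords g q)] [0..<g])"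
    using lt assms(1) by (simp_all add: coords_def)
  then have "sees_each_colour n g cs col ?zs"
    using col unfolding proper_on_triples_def list_all_iff list.map by blast
  then have "inj_on ?h (set ?es)" "?h ` set ?es = set cs"
    unfolding sees_each_colour_def Let_def distinct_map set_map by blast+
  moreover have "set ?es = ?E" unfolding set coords_def by auto
  ultimately have "bij_betw ?h ?E (set cs)"
    unfolding bij_betw_def by simp
  then have "bij_betw (?h \<circ> coords g) (extensions n g T) (set cs)"
    by (rule bij_betw_trans[OF bij_betw_coords[OF assms(1)]])
  moreover have "col (map (coords g) (sorted_list_of_set (insert d T))) = (?h \<circ> coords g) d"
    if d: "d \<in> extensions n g T" for d
  proof -
    have "d \<notin> T" using d by (auto simp: extensions_def)
    then have "sorted_list_of_set (insert d T) = insort d [p, q, r]"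
      using fin by (simp add: pqr del: insort_key.simps)
    then show ?thesis
      using d map_coords_insort[of d g "[p, q, r]"] unfolding extensions_def set by simp
  qed
  ultimately show "bij_betw (\<lambda>d. col (map (coords g) (sorted_list_of_set (insert d T))))
      (extensions n g T) (set cs)"
    by (rule bij_betw_cong[THEN iffD2, rotated])
qed

section \<open>Base colourings for the three cases\<close>

text \<open>
  Affine colourings over \<open>GF(2)^3\<close>, found by a SAT search: colours are the integers \<open>0..7\<close> read as bit
  vectors. A table maps the four groups of a block to four lists, one for each of its points, and the
  colour is the sum of the entries selected by the positions of the points in their groups.
\<close>

definition xor_colour :: "(nat list \<times> int list list) list \<Rightarrow> (nat \<times> nat) list \<Rightarrow> int" where
  "xor_colour tab zs =
     foldr xor (map2 (\<lambda>row z. row ! snd z) (the (map_of tab (map fst zs))) zs) 0"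

text \<open>Here and in \<open>table_7_2\<close> the first of the four lists absorbs the constant
  term, so the other three start with 0.\<close>

definition table_5_4 :: "(nat list \<times> int list list) list" where
  "table_5_4 = [
    ([0,1,2,3], [[2,1,6,5], [0,3,2,1], [0,1,7,6], [0,7,2,5]]),
    ([0,1,2,4], [[4,0,2,6], [0,6,5,3], [0,4,7,3], [0,2,5,7]]),
    ([0,1,3,4], [[1,2,3,0], [0,5,2,7], [0,7,4,3], [0,6,1,7]]),
    ([0,2,3,4], [[5,4,0,1], [0,2,7,5], [0,5,3,6], [0,1,3,2]]),
    ([1,2,3,4], [[7,3,6,2], [0,2,3,1], [0,4,6,2], [0,4,3,7]])]"

definition table_7_2 :: "(nat list \<times> int list list) list" where
  "table_7_2 = [
    ([0,1,2,3], [[7,4], [0,1], [0,1], [0,6]]),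
    ([0,1,2,4], [[3,0], [0,7], [0,1], [0,6]]),
    ([0,1,2,5], [[0,1], [0,5], [0,7], [0,4]]),
    ([0,1,2,6], [[6,3], [0,5], [0,3], [0,4]]),
    ([0,1,3,4], [[1,3], [0,3], [0,5], [0,2]]),
    ([0,1,3,5], [[2,7], [0,6], [0,7], [0,7]]),
    ([0,1,3,6], [[4,2], [0,5], [0,3], [0,4]]),
    ([0,1,4,5], [[6,5], [0,7], [0,7], [0,1]]),
    ([0,1,4,6], [[0,7], [0,6], [0,2], [0,5]]),
    ([0,1,5,6], [[3,4], [0,4], [0,2], [0,7]]),
    ([0,2,3,4], [[0,6], [0,4], [0,2], [0,1]]),
    ([0,2,3,5], [[3,2], [0,2], [0,5], [0,1]]),
    ([0,2,3,6], [[5,1], [0,7], [0,1], [0,1]]),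
    ([0,2,4,5], [[7,3], [0,4], [0,3], [0,2]]),
    ([0,2,4,6], [[1,2], [0,6], [0,6], [0,7]]),
    ([0,2,5,6], [[2,5], [0,4], [0,2], [0,3]]),
    ([0,3,4,5], [[5,4], [0,5], [0,2], [0,3]]),
    ([0,3,4,6], [[3,5], [0,6], [0,5], [0,4]]),
    ([0,3,5,6], [[0,3], [0,1], [0,7], [0,6]]),
    ([0,4,5,6], [[4,6], [0,1], [0,6], [0,6]]),
    ([1,2,3,4], [[5,3], [0,2], [0,2], [0,7]]),
    ([1,2,3,5], [[6,0], [0,5], [0,2], [0,7]]),
    ([1,2,3,6], [[0,2], [0,1], [0,5], [0,3]]),
    ([1,2,4,5], [[2,6], [0,6], [0,1], [0,4]]),
    ([1,2,4,6], [[4,5], [0,7], [0,5], [0,5]]),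
    ([1,2,5,6], [[7,1], [0,5], [0,5], [0,2]]),
    ([1,3,4,5], [[0,7], [0,3], [0,4], [0,2]]),
    ([1,3,4,6], [[6,4], [0,4], [0,1], [0,2]]),
    ([1,3,5,6], [[5,6], [0,3], [0,6], [0,4]]),
    ([1,4,5,6], [[1,3], [0,1], [0,4], [0,6]]),
    ([2,3,4,5], [[1,6], [0,4], [0,4], [0,5]]),
    ([2,3,4,6], [[7,0], [0,1], [0,4], [0,5]]),
    ([2,3,5,6], [[4,7], [0,7], [0,2], [0,3]]),
    ([2,4,5,6], [[0,5], [0,6], [0,3], [0,4]]),
    ([3,4,5,6], [[2,7], [0,3], [0,3], [0,1]])]"

text \<open>
  For \<open>(n, g) = (6, 3)\<close> the points form two copies of \<open>Z_9\<close>, with groups the residue classes modulo 3.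
  The part of a block in either copy is an arithmetic progression with difference 1, 4 or 7, and the
  colouring is equivariant: shifting the first or the second copy by \<open>c\<close> adds \<open>c\<close> to every colour.
  It is thus determined by the colours for the possible pairs of differences (0 for a single point).
\<close>

definition step9 :: "nat \<Rightarrow> nat \<Rightarrow> nat" where
  "step9 x y = (y + 9 - x) mod 9"

text \<open>Two points in distinct classes modulo 3 have exactly one ordering with difference 1
  modulo 3. Three points, listed by class, have cyclic steps in {1, 4, 7} with sum 0 modulo 9; this
  forces exactly two equal steps, and these are cyclically adjacent. The result is the start and the
  difference.\<close>

fun progression :: "nat list \<Rightarrow> nat \<times> nat" where
  "progression [x] = (x, 0)"
| "progression [x, y] =
     (if step9 x y mod 3 = 1 then (x, step9 x y) else (y, step9 y x))"
| "progression [x, y, z] =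
     (if step9 x y = step9 y z then (x, step9 x y)
      else if step9 y z = step9 z x then (y, step9 y z)
      else (z, step9 z x))"
| "progression _ = undefined"

text \<open>\<open>(r + 2) div 3\<close> turns the differences 0, 1, 4, 7 into the indices 0, 1, 2,
  3. Adding \<open>x + y\<close> gives the equivariance under both shifts.\<close>

definition colour_6_3 :: "(nat \<times> nat) list \<Rightarrow> nat" where
  "colour_6_3 zs =
     (let (x, r) = progression (map (\<lambda>(i, a). i + 3 * a) (filter (\<lambda>z. fst z < 3) zs));
          (y, s) = progression (map (\<lambda>(i, a). i - 3 + 3 * a) (filter (\<lambda>z. 3 \<le> fst z) zs))
      in (x + y + [[0, 1, 4, 7], [0, 4, 6, 5], [0, 2, 7, 6], [0, 6, 8, 1]]
             ! ((r + 2) div 3) ! ((s + 2) div 3)) mod 9)"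

text \<open>A triple has \<open>(n - 3) * g\<close> extensions: 8 for (5, 4) and (7, 2), and 9 for
  (6, 3). This fixes the number of colours.\<close>

lemma proper_5_4: "proper_on_triples 5 4 [0..7] (xor_colour table_5_4)"
  by code_simp

lemma proper_7_2: "proper_on_triples 7 2 [0..7] (xor_colour table_7_2)"
  by code_simp

lemma proper_6_3: "proper_on_triples 6 3 [0..<9] colour_6_3"
  by code_simp

section \<open>Assembly of the three cases\<close>

lemma LH_exists_if_dvd:
  assumes "proper_on_triples n k cs col" "k > 0" "g > 0" "k dvd g"
  shows "LH_exists n g 4 3"
proof -
  obtain m where "g = k * m" using assms(4) ..
  moreover have "LH_exists n (k * m) (Suc 3) 3" if "m > 0"
    using LH_exists_multiple[OF large_set_colouring_if_proper] assms(1,2) that by blast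
  ultimately show ?thesis using assms(3) by simp
qed

theorem theorem14:
  fixes n g :: nat
  assumes "n \<in> {5, 6, 7}"
    and "g > 0"
    and "(g * n) mod 2 = 0"
    and "(g * (n - 1) * (n - 2)) mod 3 = 0"
    and "(n, g) \<noteq> (5, 2)"
    and "\<not> (n = 5 \<and> g mod 4 = 2)"
  shows "LH_exists n g 4 3"
proof -
  consider "n = 5" | "n = 6" | "n = 7" using assms(1) by auto
  then show ?thesis
  proof cases
    case 1
    then have "4 dvd g" using assms(3,6) by presburger
    then show ?thesis using LH_exists_if_dvd[OF proper_5_4] assms(2) 1 by simp
  next
    case 2
    \<comment> \<open>For \<open>n = 6\<close> the product \<open>(n - 1) * (n - 2)\<close> is 20,
      coprime to 3.\<close>
    then have "3 dvd g" using assms(4) by simp presburger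
    then show ?thesis using LH_exists_if_dvd[OF proper_6_3] assms(2) 2 by simp
  next
    case 3
    then have "2 dvd g" using assms(3) by presburger
    then show ?thesis using LH_exists_if_dvd[OF proper_7_2] assms(2) 3 by simp
  qed
qed

end
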